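(* For any $g\in H^{\infty}$, the integral operator $S_g:BMOA\to BMOA$ is norm-attaining.
   Context: $\mathbb{D}$ is the open unit disc in $\mathbb{C}$, $H(\mathbb{D})$ is the space of analytic functions on $\mathbb{D}$, and $H^\infty$ is the set of bounded functions in $H(\mathbb{D})$. For $g\in H(\mathbb{D})$, the operator $S_g$ is defined on $H(\mathbb{D})$ by $S_gf(z)=\int_0^z f'(w)g(w)\,dw$. The Hardy space $H^2$ is the space of all $f\in H(\mathbb{D})$ with $\|f\|_{H^2}=\big(\sup_{0<r<1}\frac1{2\pi}\int_0^{2\pi}|f(re^{i\theta})|^2\,d\theta\big)^{1/2}<\infty$. For $a\in\mathbb{D}$ let $\sigma_a(z)=\frac{a-z}{1-\overline{a}z}$. $BMOA$ is the space of all $f\in H^2$ whose boundary function has bounded mean oscillation (equivalently, for which the following norm is finite), with norm $\|f\|_{BMOA}=|f(0)|+\sup_{a\in\mathbb{D}}\|f\circ\sigma_a-f(a)\|_{H^2}$. It is known that $S_g$ is bounded on $BMOA$ if and only if $g\in H^\infty$. A bounded linear operator $T:X\to Y$ between Banach spaces is norm-attaining if there is $x\in X$ with $\|x\|=1$ and $\|Tx\|=\|T\|$, where $\|T\|$ is the operator norm. *)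

theory Defs
  imports "HOL-Complex_Analysis.Complex_Analysis"
begin

text \<open>
  Functions on the open unit disc are represented by functions of type
  \<open>complex \<Rightarrow> complex\<close>, whose values outside \<open>ball 0 1\<close> are irrelevant:
  all spaces and norms below depend only on the restriction to \<open>ball 0 1\<close>.
\<close>

definition H_inf :: "(complex \<Rightarrow> complex) set" where
  "H_inf = {g. g holomorphic_on ball 0 1 \<and> bounded (g ` ball 0 1)}"

definition S_op :: "(complex \<Rightarrow> complex) \<Rightarrow> (complex \<Rightarrow> complex) \<Rightarrow> complex \<Rightarrow> complex" where
  "S_op g f = (\<lambda>z. contour_integral (linepath 0 z) (\<lambda>w. deriv f w * g w))"

definition circle_mean2 :: "(complex \<Rightarrow> complex) \<Rightarrow> real \<Rightarrow> real" where
  "circle_mean2 f r = 1 / (2 * pi) * integral {0..2 * pi} (\<lambda>t. (cmod (f (rcis r t)))\<^sup>2)"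

text \<open>
  The norms are real-valued suprema; they are meaningful only on the corresponding
  spaces, where the sets in question are required to be bounded above.
\<close>

definition H2 :: "(complex \<Rightarrow> complex) set" where
  "H2 = {f. f holomorphic_on ball 0 1 \<and> bdd_above (circle_mean2 f ` {0<..<1})}"

definition H2_norm :: "(complex \<Rightarrow> complex) \<Rightarrow> real" where
  "H2_norm f = sqrt (SUP r\<in>{0<..<1}. circle_mean2 f r)"

definition disc_aut :: "complex \<Rightarrow> complex \<Rightarrow> complex" where
  "disc_aut a z = (a - z) / (1 - cnj a * z)"

definition bmoa_shift :: "(complex \<Rightarrow> complex) \<Rightarrow> complex \<Rightarrow> complex \<Rightarrow> complex" where
  "bmoa_shift f a = (\<lambda>z. f (disc_aut a z) - f a)"

text \<open>
  The last two conditions together say that the supremum over \<open>a\<close> in the norm is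
  finite: each \<open>H2_norm (bmoa_shift f a)\<close> is finite, and these are uniformly bounded.
\<close>

definition BMOA :: "(complex \<Rightarrow> complex) set" where
  "BMOA = {f \<in> H2. (\<forall>a\<in>ball 0 1. bmoa_shift f a \<in> H2) \<and>
                   bdd_above ((\<lambda>a. H2_norm (bmoa_shift f a)) ` ball 0 1)}"

definition BMOA_norm :: "(complex \<Rightarrow> complex) \<Rightarrow> real" where
  "BMOA_norm f = cmod (f 0) + (SUP a\<in>ball 0 1. H2_norm (bmoa_shift f a))"

text \<open>
  Operators between spaces \<open>X\<close>, \<open>Y\<close> of functions on the disc, with norms \<open>nX\<close>, \<open>nY\<close>.
  Linearity is an identity of functions on the disc.
\<close>

definition bounded_linear_op ::
  "(complex \<Rightarrow> complex) set \<Rightarrow> ((complex \<Rightarrow> complex) \<Rightarrow> real) \<Rightarrow>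
   (complex \<Rightarrow> complex) set \<Rightarrow> ((complex \<Rightarrow> complex) \<Rightarrow> real) \<Rightarrow>
   ((complex \<Rightarrow> complex) \<Rightarrow> (complex \<Rightarrow> complex)) \<Rightarrow> bool" where
  "bounded_linear_op X nX Y nY T \<longleftrightarrow>
     (\<forall>f\<in>X. T f \<in> Y) \<and>
     (\<forall>f\<in>X. \<forall>h\<in>X. \<forall>z\<in>ball 0 1. T (\<lambda>w. f w + h w) z = T f z + T h z) \<and>
     (\<forall>c. \<forall>f\<in>X. \<forall>z\<in>ball 0 1. T (\<lambda>w. c * f w) z = c * T f z) \<and>
     (\<exists>C. \<forall>f\<in>X. nY (T f) \<le> C * nX f)"

definition op_norm ::
  "(complex \<Rightarrow> complex) set \<Rightarrow> ((complex \<Rightarrow> complex) \<Rightarrow> real) \<Rightarrow>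
   ((complex \<Rightarrow> complex) \<Rightarrow> real) \<Rightarrow> ((complex \<Rightarrow> complex) \<Rightarrow> (complex \<Rightarrow> complex)) \<Rightarrow> real" where
  "op_norm X nX nY T = (SUP f\<in>{f \<in> X. nX f \<le> 1}. nY (T f))"

definition norm_attaining ::
  "(complex \<Rightarrow> complex) set \<Rightarrow> ((complex \<Rightarrow> complex) \<Rightarrow> real) \<Rightarrow>
   (complex \<Rightarrow> complex) set \<Rightarrow> ((complex \<Rightarrow> complex) \<Rightarrow> real) \<Rightarrow>
   ((complex \<Rightarrow> complex) \<Rightarrow> (complex \<Rightarrow> complex)) \<Rightarrow> bool" where
  "norm_attaining X nX Y nY T \<longleftrightarrow>
     bounded_linear_op X nX Y nY T \<and>
     (\<exists>f\<in>X. nX f = 1 \<and> nY (T f) = op_norm X nX nY T)"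

end

theory Submission
  imports Defs
begin

text \<open>
  Let \<open>M\<close> be the supremum of \<open>cmod (g z)\<close> over the unit disc.  The operator norm of \<open>S_op g\<close>
  turns out to be \<open>M\<close>, and a Blaschke product attains it.

  Upper bound.  Each shift of \<open>S_op g f\<close> has the derivative of the corresponding shift of
  \<open>f\<close>, multiplied by a function bounded by \<open>M\<close>.  By a Littlewood--Paley argument
  (\<open>circle_mean2_comparison\<close>) its Hardy norm is therefore at most \<open>M\<close> times that of the shift of
  \<open>f\<close>.  Hence \<open>BMOA_norm (S_op g f) \<le> M * BMOA_norm f\<close> (\<open>S_op_in_BMOA\<close>).

  Lower bound.  The Hardy norm dominates the modulus of the first Taylor coefficient, so
  \<open>BMOA_norm f\<close> is at least the hyperbolic derivative \<open>(1 - (cmod a)\<^sup>2) * cmod (deriv f a)\<close>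
  at every point \<open>a\<close> of the disc (\<open>hyperbolic_deriv_le_BMOA_norm\<close>), and
  \<open>BMOA_norm (S_op g f)\<close> is at least this number times \<open>cmod (g a)\<close>.
  It therefore suffices to find a function \<open>f\<close> bounded by 1 with \<open>f 0 = 0\<close>, whose norm is
  then at most 1 (\<open>self_map_in_BMOA\<close>), and points \<open>a k\<close> at which both its hyperbolic derivative
  tends to 1 and \<open>cmod (g (a k))\<close> tends to \<open>M\<close>; such an \<open>f\<close> has norm 1 and attains \<open>M\<close>.

  By the maximum modulus principle the points \<open>a k\<close> can be taken as close to the unit circle as
  desired, and hence as sparse as desired in the pseudohyperbolic distance
  (\<open>sparse_maximizing_sequence\<close>).  A limit of the finite Blaschke products with zeros \<open>a k\<close> is the
  required function: the hyperbolic derivative of a finite product at \<open>a k\<close> is the product of the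
  pseudohyperbolic distances from \<open>a k\<close> to the other zeros, and sparseness bounds it below,
  independently of the number of factors, by a quantity that tends to 1 (\<open>Blaschke_limit\<close>).
\<close>


section \<open>Quadratic means over circles\<close>

lemma has_integral_cis_multiple:
  fixes k :: int
  shows "((\<lambda>t. cis (of_int k * t)) has_integral (if k = 0 then 2 * pi else 0)) {0..2 * pi}"
proof (cases "k = 0")
  case True
  have "((\<lambda>t::real. 1::complex) has_integral ((2 * pi) *\<^sub>R 1)) {0..2 * pi}"
    using has_integral_const_real[of "1::complex" 0 "2 * pi"] by simp
  then show ?thesis using True by (simp add: scaleR_conv_of_real)
next
  case False
  have "((\<lambda>t. cis (of_int k * t)) has_integral
      (cis (of_int k * (2 * pi)) / (\<i> * of_int k) - cis (of_int k * 0) / (\<i> * of_int k))) {0..2 * pi}"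
  proof (rule fundamental_theorem_of_calculus)
    fix x :: real
    have "((\<lambda>z. exp (\<i> * (of_int k * z)) / (\<i> * of_int k)) has_field_derivative
        exp (\<i> * (of_int k * of_real x))) (at (of_real x))"
      using False by (auto intro!: derivative_eq_intros simp: mult.commute[of _ "\<i>"])
    from has_vector_derivative_real_field[OF this]
    show "((\<lambda>t. cis (of_int k * t) / (\<i> * of_int k)) has_vector_derivative cis (of_int k * x))
        (at x within {0..2 * pi})"
      by (simp add: cis_conv_exp)
  qed simp
  moreover have "cis (of_int k * (2 * pi)) = 1"
    using cis_multiple_2pi[of "of_int k"] by (simp add: mult.commute)
  ultimately show ?thesis using False by simp
qed

lemma has_integral_norm_trig_polynomial:
  fixes A :: "nat \<Rightarrow> complex"
  assumes "finite I"
  shows "((\<lambda>t. (cmod (\<Sum>n\<in>I. A n * cis (real n * t)))\<^sup>2) has_integral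
           2 * pi * (\<Sum>n\<in>I. (cmod (A n))\<^sup>2)) {0..2 * pi}"
proof -
  have "((\<lambda>t. \<Sum>m\<in>I. \<Sum>n\<in>I. A m * cnj (A n) * cis (of_int (int m - int n) * t)) has_integral
        (\<Sum>m\<in>I. \<Sum>n\<in>I. A m * cnj (A n) * (if int m - int n = 0 then 2 * pi else 0))) {0..2 * pi}"
    by (intro has_integral_sum assms has_integral_mult_right has_integral_cis_multiple)
  moreover have "(\<Sum>m\<in>I. \<Sum>n\<in>I. A m * cnj (A n) * cis (of_int (int m - int n) * t))
      = of_real ((cmod (\<Sum>n\<in>I. A n * cis (real n * t)))\<^sup>2)" for t
    unfolding complex_norm_square
    by (simp add: sum_product cis_cnj mult_ac cis_mult algebra_simps)
  moreover have "(\<Sum>m\<in>I. \<Sum>n\<in>I. A m * cnj (A n) * of_real (if int m - int n = 0 then 2 * pi else 0))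
      = of_real (2 * pi * (\<Sum>n\<in>I. (cmod (A n))\<^sup>2))"
  proof -
    have "(\<Sum>n\<in>I. A m * cnj (A n) * of_real (if int m - int n = 0 then 2 * pi else 0))
        = of_real (2 * pi * (cmod (A m))\<^sup>2)" if "m \<in> I" for m
    proof -
      have "(\<Sum>n\<in>I. A m * cnj (A n) * of_real (if int m - int n = 0 then 2 * pi else 0))
          = (\<Sum>n\<in>I. if m = n then A m * cnj (A m) * of_real (2 * pi) else 0)"
        by (intro sum.cong) auto
      also have "\<dots> = of_real (2 * pi * (cmod (A m))\<^sup>2)"
        using assms that by (simp only: sum.delta of_real_mult complex_norm_square if_True) simp
      finally show ?thesis .
    qed
    then show ?thesis by (simp add: sum_distrib_left)
  qed
  ultimately have "((\<lambda>t. complex_of_real ((cmod (\<Sum>n\<in>I. A n * cis (real n * t)))\<^sup>2)) has_integral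
           of_real (2 * pi * (\<Sum>n\<in>I. (cmod (A n))\<^sup>2))) {0..2 * pi}"
    by simp
  from has_integral_linear[OF this bounded_linear_Re] show ?thesis
    by (simp add: o_def del: of_real_power of_real_mult)
qed

text \<open>
  The \<open>n\<close>-th Taylor coefficient of \<open>f\<close> at the origin.
\<close>

abbreviation taylor0 :: "(complex \<Rightarrow> complex) \<Rightarrow> nat \<Rightarrow> complex" where
  "taylor0 f n \<equiv> (deriv ^^ n) f 0 / fact n"

text \<open>
  Parseval's identity on the circle of radius \<open>r\<close>.  The Taylor series converges uniformly
  there, so the identity passes from the partial sums to the limit.
\<close>

lemma circle_mean2_sums:
  assumes holf: "f holomorphic_on ball 0 1" and r: "0 < r" "r < 1"
  shows "(\<lambda>n. (cmod (taylor0 f n))\<^sup>2 * (r\<^sup>2) ^ n) sums circle_mean2 f r"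
proof -
  define A where "A n = taylor0 f n * of_real r ^ n" for n
  define R where "R = (1 + r) / 2"
  have R: "r < R" "R < 1" "0 < R" using r by (auto simp: R_def)
  have sums: "(\<lambda>n. taylor0 f n * z ^ n) sums f z" if "cmod z < 1" for z
    using holomorphic_power_series[OF holf, of z] that by simp
  have "summable (\<lambda>n. norm (taylor0 f n * of_real r ^ n))"
    by (rule powser_insidea[of _ "of_real R"]) (use sums[of "of_real R"] R r in \<open>auto simp: sums_iff\<close>)
  then have summ: "summable (\<lambda>n. norm (A n))" by (simp add: A_def)
  have Asums: "(\<lambda>n. A n * cis (real n * t)) sums f (rcis r t)" for t
  proof -
    have "taylor0 f n * rcis r t ^ n = A n * cis (real n * t)" for n
      unfolding DeMoivre2 by (simp add: A_def rcis_def)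
    then show ?thesis using sums[of "rcis r t"] r by simp
  qed
  have ul: "uniform_limit {0..2 * pi} (\<lambda>N t. \<Sum>n<N. A n * cis (real n * t)) (\<lambda>t. f (rcis r t)) sequentially"
  proof -
    have "uniform_limit {0..2 * pi} (\<lambda>N t. \<Sum>n<N. A n * cis (real n * t))
        (\<lambda>t. \<Sum>n. A n * cis (real n * t)) sequentially"
      by (rule Weierstrass_m_test[OF _ summ]) (simp add: norm_mult)
    then show ?thesis using Asums by (simp add: sums_iff)
  qed
  have cont: "continuous_on {0..2*pi} (\<lambda>t. f (rcis r t))"
  proof (rule continuous_on_compose2[OF holomorphic_on_imp_continuous_on[OF holf]])
    show "continuous_on {0..2 * pi} (rcis r)"
      unfolding rcis_def by (intro continuous_intros)
  qed (use r in auto)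
  have ul2: "uniform_limit {0..2 * pi} (\<lambda>N t. (cmod (\<Sum>n<N. A n * cis (real n * t)))\<^sup>2)
      (\<lambda>t. (cmod (f (rcis r t)))\<^sup>2) sequentially"
    unfolding power2_eq_square
    by (intro uniform_lim_mult uniform_limit_norm ul compact_imp_bounded
        compact_continuous_image continuous_intros cont) auto
  obtain I J where I: "\<And>N. ((\<lambda>t. (cmod (\<Sum>n<N. A n * cis (real n * t)))\<^sup>2) has_integral I N) {0..2*pi}"
    and J: "((\<lambda>t. (cmod (f (rcis r t)))\<^sup>2) has_integral J) {0..2*pi}" and lim: "I \<longlonglongrightarrow> J"
    by (rule uniform_limit_integral[OF ul2]) (auto intro!: continuous_intros simp: cis_conv_exp)
  have "I N = 2 * pi * (\<Sum>n<N. (cmod (A n))\<^sup>2)" for N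
    using has_integral_unique[OF I has_integral_norm_trig_polynomial] by blast
  then have I2: "1 / (2 * pi) * I N = (\<Sum>n<N. (cmod (A n))\<^sup>2)" for N by simp
  have "(\<lambda>N. 1 / (2 * pi) * I N) \<longlonglongrightarrow> 1 / (2 * pi) * J" by (intro tendsto_intros lim)
  then have "(\<lambda>n. (cmod (A n))\<^sup>2) sums circle_mean2 f r"
    unfolding I2 sums_def circle_mean2_def using J by (simp add: integral_unique)
  moreover have "(cmod (A n))\<^sup>2 = (cmod (taylor0 f n))\<^sup>2 * (r\<^sup>2) ^ n" for n
  proof -
    have "cmod (A n) = cmod (taylor0 f n) * r ^ n"
      using r by (simp add: A_def norm_mult norm_power norm_divide)
    moreover have "(r ^ n)\<^sup>2 = (r\<^sup>2) ^ n"
      by (simp flip: power_mult add: mult.commute)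
    ultimately show ?thesis by (simp only: power_mult_distrib)
  qed
  ultimately show ?thesis by simp
qed

lemma circle_mean2_diff_at_0_le:
  assumes "f holomorphic_on ball 0 1" "0 < r" "r < 1"
  shows "circle_mean2 (\<lambda>z. f z - f 0) r \<le> circle_mean2 f r"
proof (rule sums_le)
  show "(\<lambda>n. (cmod (taylor0 f n))\<^sup>2 * (r\<^sup>2) ^ n) sums circle_mean2 f r"
    by (intro circle_mean2_sums assms)
  show "(\<lambda>n. (cmod (taylor0 (\<lambda>z. f z - f 0) n))\<^sup>2 * (r\<^sup>2) ^ n) sums circle_mean2 (\<lambda>z. f z - f 0) r"
    by (intro circle_mean2_sums assms holomorphic_intros)
  show "(cmod (taylor0 (\<lambda>z. f z - f 0) n))\<^sup>2 * (r\<^sup>2) ^ n \<le> (cmod (taylor0 f n))\<^sup>2 * (r\<^sup>2) ^ n" for n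
  proof (cases n)
    case (Suc m)
    have "(deriv ^^ n) (\<lambda>z. f z - f 0) 0 = (deriv ^^ n) f 0 - (deriv ^^ n) (\<lambda>z. f 0) 0"
      by (rule higher_deriv_diff[of _ "ball 0 1"]) (use assms in auto)
    moreover have "(deriv ^^ n) (\<lambda>z. f 0) 0 = 0" using Suc by (simp add: higher_deriv_const)
    ultimately show ?thesis by simp
  qed simp
qed

lemma circle_mean2_ge_deriv_0:
  assumes "f holomorphic_on ball 0 1" "0 < r" "r < 1"
  shows "(cmod (deriv f 0))\<^sup>2 * r\<^sup>2 \<le> circle_mean2 f r"
proof -
  have s: "(\<lambda>n. (cmod (taylor0 f n))\<^sup>2 * (r\<^sup>2) ^ n) sums circle_mean2 f r"
    by (intro circle_mean2_sums assms)
  have "(\<Sum>n\<in>{1}. (cmod (taylor0 f n))\<^sup>2 * (r\<^sup>2) ^ n) \<le> (\<Sum>n. (cmod (taylor0 f n))\<^sup>2 * (r\<^sup>2) ^ n)"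
    by (rule sum_le_suminf) (use s in \<open>auto simp: sums_iff\<close>)
  then show ?thesis using s by (simp add: sums_iff)
qed

lemma circle_mean2_mono:
  assumes "F holomorphic_on ball 0 1" "H holomorphic_on ball 0 1" "0 < r" "r < 1"
    and le: "\<And>z. z \<in> ball 0 1 \<Longrightarrow> cmod (F z) \<le> M * cmod (H z)"
  shows "circle_mean2 F r \<le> M\<^sup>2 * circle_mean2 H r"
proof -
  have i: "(\<lambda>t. (cmod (f (rcis r t)))\<^sup>2) integrable_on {0..2*pi}" if "f holomorphic_on ball 0 1" for f
    by (intro integrable_continuous_interval continuous_intros
        continuous_on_compose2[OF holomorphic_on_imp_continuous_on[OF that]])
      (use assms in \<open>auto intro!: continuous_intros simp: rcis_def norm_mult\<close>)
  have "(cmod (F (rcis r t)))\<^sup>2 \<le> M\<^sup>2 * (cmod (H (rcis r t)))\<^sup>2" for t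
    using power_mono[OF le[of "rcis r t"], of 2] assms by (simp add: power_mult_distrib)
  then have "integral {0..2*pi} (\<lambda>t. (cmod (F (rcis r t)))\<^sup>2)
      \<le> integral {0..2*pi} (\<lambda>t. M\<^sup>2 * (cmod (H (rcis r t)))\<^sup>2)"
    by (intro integral_le i assms integrable_on_mult_right)
  then show ?thesis
    unfolding circle_mean2_def by (simp add: divide_right_mono)
qed

lemma circle_mean2_le_1:
  assumes "F holomorphic_on ball 0 1" "0 < r" "r < 1"
    and le: "\<And>z. z \<in> ball 0 1 \<Longrightarrow> cmod (F z) \<le> 1"
  shows "circle_mean2 F r \<le> 1"
  using circle_mean2_mono[of F "\<lambda>_. 1" r 1] assms by (simp add: circle_mean2_def)

text \<open>
  The Littlewood--Paley principle: if \<open>F 0 = 0\<close>, a pointwise bound between derivatives gives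
  the same bound between the quadratic means over each circle.  The argument below takes the
  place of the area integral.  Put \<open>p n = M\<^sup>2 \<bar>h n\<bar>\<^sup>2 - \<bar>f n\<bar>\<^sup>2\<close>, where \<open>h\<close> and \<open>f\<close> are the
  Taylor coefficients of \<open>H\<close> and \<open>F\<close>, and \<open>P t = (\<Sum>n. p n * t ^ n)\<close>.  Parseval's identity
  for \<open>F\<close> and \<open>H\<close> says that \<open>P (r\<^sup>2)\<close> is the difference to be bounded below by 0; for the
  derivatives of \<open>F\<close> and \<open>H\<close> it says, in view of the pointwise bound, that the derivative of
  \<open>t * P' t\<close> is nonnegative.
  Integrating twice from 0 yields \<open>P \<ge> 0\<close>.
\<close>

lemma circle_mean2_comparison:
  assumes F: "F holomorphic_on ball 0 1" and H: "H holomorphic_on ball 0 1"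
    and r: "0 < r" "r < 1" and F0: "F 0 = 0"
    and le: "\<And>z. z \<in> ball 0 1 \<Longrightarrow> cmod (deriv F z) \<le> M * cmod (deriv H z)"
  shows "circle_mean2 F r \<le> M\<^sup>2 * circle_mean2 H r"
proof -
  define p where "p n = M\<^sup>2 * (cmod (taylor0 H n))\<^sup>2 - (cmod (taylor0 F n))\<^sup>2" for n
  have ps: "(\<lambda>n. p n * (s\<^sup>2) ^ n) sums (M\<^sup>2 * circle_mean2 H s - circle_mean2 F s)"
    if "0 < s" "s < 1" for s
    unfolding p_def left_diff_distrib mult.assoc
    by (intro sums_diff sums_mult circle_mean2_sums F H that)
  have summ: "summable (\<lambda>n. p n * t ^ n)" if "norm t < 1" for t
  proof -
    define s where "s = sqrt ((1 + \<bar>t\<bar>) / 2)"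
    have s: "0 < s" "s < 1" "s\<^sup>2 = (1 + \<bar>t\<bar>) / 2" using that by (auto simp: s_def)
    show ?thesis
    proof (rule powser_inside[of _ "s\<^sup>2"])
      show "summable (\<lambda>n. p n * (s\<^sup>2) ^ n)"
        using ps[OF s(1,2)] by (rule sums_summable)
    qed (use s(3) that in auto)
  qed
  \<comment> \<open>the coefficients of \<open>t * P' t\<close>\<close>
  define q where "q n = real n * p n" for n
  have summ_d: "summable (\<lambda>n. diffs p n * t ^ n)" if "norm t < 1" for t
    by (rule termdiff_converges[OF that]) (use summ in auto)
  have qs: "(\<lambda>n. q n * t ^ n) sums (t * (\<Sum>n. diffs p n * t ^ n))" if "norm t < 1" for t
  proof -
    have "(\<lambda>n. t * (diffs p n * t ^ n)) sums (t * (\<Sum>n. diffs p n * t ^ n))"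
      by (intro sums_mult summable_sums summ_d that)
    then have "(\<lambda>n. q (Suc n) * t ^ Suc n) sums (t * (\<Sum>n. diffs p n * t ^ n))"
      by (simp add: q_def diffs_def mult_ac)
    then show ?thesis by (subst (asm) sums_Suc_iff) (simp add: q_def)
  qed
  have dd: "(\<Sum>n. diffs q n * t ^ n) \<ge> 0" if t: "0 < t" "t < 1" for t
  proof -
    define s where "s = sqrt t"
    have s: "0 < s" "s < 1" "s\<^sup>2 = t" using t by (auto simp: s_def)
    have dt: "taylor0 (deriv f) n = of_nat (Suc n) * taylor0 f (Suc n)" for f n
      by (simp add: funpow_swap1 del: of_nat_Suc)
    have sm: "(\<lambda>n. M\<^sup>2 * ((cmod (taylor0 (deriv H) n))\<^sup>2 * (s\<^sup>2) ^ n) - (cmod (taylor0 (deriv F) n))\<^sup>2 * (s\<^sup>2) ^ n)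
        sums (M\<^sup>2 * circle_mean2 (deriv H) s - circle_mean2 (deriv F) s)"
      by (intro sums_diff sums_mult circle_mean2_sums holomorphic_deriv F H s open_ball)
    have eq: "M\<^sup>2 * ((cmod (taylor0 (deriv H) n))\<^sup>2 * (s\<^sup>2) ^ n) - (cmod (taylor0 (deriv F) n))\<^sup>2 * (s\<^sup>2) ^ n
       = diffs q n * t ^ n" for n
      unfolding dt norm_mult norm_of_nat diffs_def q_def p_def s(3)
      by (simp add: algebra_simps power2_eq_square del: of_nat_Suc)
    have "(\<lambda>n. diffs q n * t ^ n) sums (M\<^sup>2 * circle_mean2 (deriv H) s - circle_mean2 (deriv F) s)"
      using sm unfolding eq .
    moreover have "circle_mean2 (deriv F) s \<le> M\<^sup>2 * circle_mean2 (deriv H) s"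
      by (intro circle_mean2_mono holomorphic_deriv F H s open_ball le)
    ultimately show ?thesis by (simp add: sums_iff)
  qed
  have qpos: "(\<Sum>n. q n * t ^ n) \<ge> 0" if t: "0 < t" "t < 1" for t
  proof -
    have D: "DERIV (\<lambda>t. \<Sum>n. q n * t ^ n) x :> (\<Sum>n. diffs q n * x ^ n)" if "norm x < 1" for x
      by (rule termdiffs_strong'[OF _ that]) (use qs in \<open>auto simp: sums_iff\<close>)
    have "(\<Sum>n. q n * 0 ^ n) \<le> (\<Sum>n. q n * t ^ n)"
    proof (rule DERIV_nonneg_imp_increasing_open[of 0 t])
      show "continuous_on {0..t} (\<lambda>t. \<Sum>n. q n * t ^ n)"
        by (rule DERIV_continuous_on[OF has_field_derivative_at_within[OF D]]) (use t in auto)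
      show "\<exists>y. ((\<lambda>t. \<Sum>n. q n * t ^ n) has_real_derivative y) (at x) \<and> 0 \<le> y"
        if "0 < x" "x < t" for x
        using D[of x] dd[of x] that t by auto
    qed (use t in auto)
    then show ?thesis by (simp add: q_def)
  qed
  have dpos: "(\<Sum>n. diffs p n * t ^ n) \<ge> 0" if t: "0 < t" "t < 1" for t
    using qpos[OF t] qs[of t] t by (simp add: sums_iff zero_le_mult_iff)
  have D: "DERIV (\<lambda>t. \<Sum>n. p n * t ^ n) x :> (\<Sum>n. diffs p n * x ^ n)" if "norm x < 1" for x
    by (rule termdiffs_strong'[OF _ that]) (use summ in auto)
  have r2: "0 < r\<^sup>2" "r\<^sup>2 < 1" using r by (auto simp: power_less_one_iff)
  have "(\<Sum>n. p n * 0 ^ n) \<le> (\<Sum>n. p n * (r\<^sup>2) ^ n)"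
  proof (rule DERIV_nonneg_imp_increasing_open[of 0 "r\<^sup>2"])
    show "continuous_on {0..r\<^sup>2} (\<lambda>t. \<Sum>n. p n * t ^ n)"
      by (rule DERIV_continuous_on[OF has_field_derivative_at_within[OF D]]) (use r2 in auto)
    show "\<exists>y. ((\<lambda>t. \<Sum>n. p n * t ^ n) has_real_derivative y) (at x) \<and> 0 \<le> y"
      if "0 < x" "x < r\<^sup>2" for x
      using D[of x] dpos[of x] that r2 by auto
  qed (use r2 in auto)
  moreover have "(\<Sum>n. p n * 0 ^ n) \<ge> 0" by (simp add: p_def F0)
  ultimately show ?thesis using ps[OF r] by (simp add: sums_iff)
qed


section \<open>Automorphisms of the disc and BMOA shifts\<close>

lemma disc_aut_conv_Moebius: "disc_aut a z = - Moebius_function 0 a z"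
  unfolding disc_aut_def Moebius_function_simple by (simp only: minus_divide_left minus_diff_eq)

lemma norm_disc_aut_less_1: "cmod a < 1 \<Longrightarrow> cmod z < 1 \<Longrightarrow> cmod (disc_aut a z) < 1"
  by (simp add: disc_aut_conv_Moebius Moebius_function_norm_lt_1)

lemma disc_aut_holomorphic: "cmod a < 1 \<Longrightarrow> disc_aut a holomorphic_on ball 0 1"
  using Moebius_function_holomorphic[of a 0]
  by (auto simp: disc_aut_conv_Moebius[abs_def] intro!: holomorphic_intros)

lemma disc_aut_0 [simp]: "disc_aut a 0 = a"
  by (simp add: disc_aut_def)

lemma disc_aut_self [simp]: "disc_aut a a = 0"
  by (simp add: disc_aut_def)

lemma one_minus_cnj_mult_nonzero:
  assumes "cmod a < 1" "cmod z < 1"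
  shows "1 - cnj a * z \<noteq> 0"
proof
  assume "1 - cnj a * z = 0"
  then have "cmod a * cmod z = 1" by (metis complex_mod_cnj eq_iff_diff_eq_0 norm_mult norm_one)
  then show False using assms norm_mult_less[of a 1 z 1] by (simp add: norm_mult)
qed

lemma norm_disc_aut_commute: "cmod (disc_aut a b) = cmod (disc_aut b a)"
proof -
  have "cmod (1 - cnj a * b) = cmod (cnj (1 - cnj a * b))" by (simp only: complex_mod_cnj)
  then show ?thesis by (simp add: disc_aut_def norm_divide norm_minus_commute mult.commute)
qed

lemma one_minus_norm_disc_aut_power2:
  assumes "cmod a < 1" "cmod z < 1"
  shows "1 - (cmod (disc_aut a z))\<^sup>2 = (1 - (cmod a)\<^sup>2) * (1 - (cmod z)\<^sup>2) / (cmod (1 - cnj a * z))\<^sup>2"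
proof -
  have "(cmod (1 - cnj a * z))\<^sup>2 - (cmod (a - z))\<^sup>2 = (1 - (cmod a)\<^sup>2) * (1 - (cmod z)\<^sup>2)"
    by (simp only: cmod_power2) (simp add: power2_eq_square algebra_simps)
  then show ?thesis
    using one_minus_cnj_mult_nonzero[OF assms]
    by (simp add: disc_aut_def norm_divide power_divide field_simps)
qed

lemma disc_aut_has_field_derivative:
  assumes "cmod a < 1" "cmod z < 1"
  shows "(disc_aut a has_field_derivative - of_real (1 - (cmod a)\<^sup>2) / (1 - cnj a * z)\<^sup>2) (at z)"
proof -
  have "of_real ((cmod a)\<^sup>2) = a * cnj a" by (rule complex_norm_square)
  then show ?thesis
    unfolding disc_aut_def[abs_def] using one_minus_cnj_mult_nonzero[OF assms]
    by (auto intro!: derivative_eq_intros simp: power2_eq_square) (simp add: algebra_simps)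
qed

lemma bmoa_shift_has_field_derivative:
  assumes "f holomorphic_on ball 0 1" "cmod a < 1" "cmod z < 1"
  shows "(bmoa_shift f a has_field_derivative
           deriv f (disc_aut a z) * deriv (disc_aut a) z) (at z)"
proof -
  have "(f has_field_derivative deriv f (disc_aut a z)) (at (disc_aut a z))"
    by (rule holomorphic_derivI[OF assms(1)]) (use norm_disc_aut_less_1 assms in auto)
  moreover have "(disc_aut a has_field_derivative deriv (disc_aut a) z) (at z)"
    by (rule holomorphic_derivI[OF disc_aut_holomorphic]) (use assms in auto)
  ultimately show ?thesis
    unfolding bmoa_shift_def
    using DERIV_diff[OF DERIV_chain2 DERIV_const, of f _ "disc_aut a"] by simp
qed

lemma bmoa_shift_holomorphic:
  assumes "f holomorphic_on ball 0 1" "cmod a < 1"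
  shows "bmoa_shift f a holomorphic_on ball 0 1"
  by (rule holomorphic_onI)
     (use bmoa_shift_has_field_derivative[OF assms] in \<open>auto simp: field_differentiable_def
        intro: has_field_derivative_at_within\<close>)

lemma bmoa_shift_0 [simp]: "bmoa_shift f a 0 = 0"
  by (simp add: bmoa_shift_def)

lemma norm_deriv_bmoa_shift_0:
  assumes "f holomorphic_on ball 0 1" "cmod a < 1"
  shows "cmod (deriv (bmoa_shift f a) 0) = (1 - (cmod a)\<^sup>2) * cmod (deriv f a)"
proof -
  have "deriv (disc_aut a) 0 = - of_real (1 - (cmod a)\<^sup>2)"
    using DERIV_imp_deriv[OF disc_aut_has_field_derivative[of a 0]] assms by simp
  moreover have "(cmod a)\<^sup>2 \<le> 1" using assms by (simp add: power_le_one)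
  ultimately have "cmod (deriv (disc_aut a) 0) = 1 - (cmod a)\<^sup>2"
    by (simp only: norm_minus_cancel norm_of_real)
  then show ?thesis
    using DERIV_imp_deriv[OF bmoa_shift_has_field_derivative[OF assms, of 0]] by (simp add: norm_mult)
qed

section \<open>The norms of the Hardy space and of BMOA\<close>

lemma circle_mean2_nonneg: "circle_mean2 f r \<ge> 0"
proof -
  have "0 \<le> integral {0..2 * pi} (\<lambda>t. (cmod (f (rcis r t)))\<^sup>2)"
    by (cases "(\<lambda>t. (cmod (f (rcis r t)))\<^sup>2) integrable_on {0..2 * pi}")
       (auto simp: not_integrable_integral intro!: integral_nonneg)
  then show ?thesis by (simp add: circle_mean2_def)
qed

lemma H2_norm_power2:
  assumes "f \<in> H2"
  shows "(H2_norm f)\<^sup>2 = (SUP r\<in>{0<..<1}. circle_mean2 f r)" "H2_norm f \<ge> 0"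
proof -
  have "0 \<le> circle_mean2 f (1/2)" by (rule circle_mean2_nonneg)
  also have "\<dots> \<le> (SUP r\<in>{0<..<1}. circle_mean2 f r)"
    by (rule cSUP_upper) (use assms in \<open>auto simp: H2_def\<close>)
  finally show "(H2_norm f)\<^sup>2 = (SUP r\<in>{0<..<1}. circle_mean2 f r)" "H2_norm f \<ge> 0"
    by (auto simp: H2_norm_def)
qed

lemma circle_mean2_le_H2_norm:
  assumes "f \<in> H2" "0 < r" "r < 1"
  shows "circle_mean2 f r \<le> (H2_norm f)\<^sup>2"
  unfolding H2_norm_power2[OF assms(1)]
  by (rule cSUP_upper) (use assms in \<open>auto simp: H2_def\<close>)

lemma H2_normI:
  assumes "f holomorphic_on ball 0 1" "C \<ge> 0"
    and "\<And>r. 0 < r \<Longrightarrow> r < 1 \<Longrightarrow> circle_mean2 f r \<le> C\<^sup>2"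
  shows "f \<in> H2" "H2_norm f \<le> C"
proof -
  show *: "f \<in> H2" using assms by (auto simp: H2_def intro!: bdd_aboveI2)
  have "(SUP r\<in>{0<..<1::real}. circle_mean2 f r) \<le> C\<^sup>2"
    by (rule cSUP_least) (use assms in auto)
  then show "H2_norm f \<le> C"
    using assms(2) by (simp add: H2_norm_def real_le_lsqrt)
qed

lemma norm_deriv_0_le_H2_norm:
  assumes "f \<in> H2"
  shows "cmod (deriv f 0) \<le> H2_norm f"
proof (rule field_le_mult_one_interval)
  fix r :: real assume r: "0 < r" "r < 1"
  have "(r * cmod (deriv f 0))\<^sup>2 \<le> circle_mean2 f r"
    using circle_mean2_ge_deriv_0[OF _ r, of f] assms by (simp add: H2_def power_mult_distrib mult.commute)
  also have "\<dots> \<le> (H2_norm f)\<^sup>2" by (rule circle_mean2_le_H2_norm[OF assms r])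
  finally show "r * cmod (deriv f 0) \<le> H2_norm f"
    by (rule power2_le_imp_le) (rule H2_norm_power2[OF assms])
qed

lemma BMOA_imp_holomorphic: "f \<in> BMOA \<Longrightarrow> f holomorphic_on ball 0 1"
  by (simp add: BMOA_def H2_def)

lemma H2_norm_bmoa_shift_le:
  assumes "f \<in> BMOA" "cmod a < 1"
  shows "H2_norm (bmoa_shift f a) \<le> BMOA_norm f - cmod (f 0)"
  unfolding BMOA_norm_def add_diff_cancel_left'
  by (rule cSUP_upper) (use assms in \<open>auto simp: BMOA_def\<close>)

lemma BMOA_normI:
  assumes "f \<in> H2" "\<And>a. cmod a < 1 \<Longrightarrow> bmoa_shift f a \<in> H2"
    "\<And>a. cmod a < 1 \<Longrightarrow> H2_norm (bmoa_shift f a) \<le> C"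
  shows "f \<in> BMOA" "BMOA_norm f \<le> cmod (f 0) + C"
proof -
  show "f \<in> BMOA"
    using assms by (auto simp: BMOA_def intro!: bdd_aboveI2)
  show "BMOA_norm f \<le> cmod (f 0) + C"
    unfolding BMOA_norm_def by (intro add_left_mono cSUP_least) (use assms in auto)
qed

text \<open>
  The left-hand side is the modulus of the first Taylor coefficient of \<open>bmoa_shift f a\<close>.
\<close>

lemma hyperbolic_deriv_le_BMOA_norm:
  assumes "f \<in> BMOA" "cmod a < 1"
  shows "(1 - (cmod a)\<^sup>2) * cmod (deriv f a) \<le> BMOA_norm f"
proof -
  have "(1 - (cmod a)\<^sup>2) * cmod (deriv f a) = cmod (deriv (bmoa_shift f a) 0)"
    using norm_deriv_bmoa_shift_0[OF BMOA_imp_holomorphic assms(2)] assms(1) by simp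
  also have "\<dots> \<le> H2_norm (bmoa_shift f a)"
    by (rule norm_deriv_0_le_H2_norm) (use assms in \<open>auto simp: BMOA_def\<close>)
  also have "\<dots> \<le> BMOA_norm f - cmod (f 0)" by (rule H2_norm_bmoa_shift_le[OF assms])
  finally show ?thesis using norm_ge_zero[of "f 0"] by linarith
qed

text \<open>
  Subtracting the value at the origin only removes the constant Taylor coefficient, so
  it does not increase the quadratic means of \<open>f \<circ> disc_aut a\<close>, and these are at most 1.
\<close>

lemma self_map_in_BMOA:
  assumes f: "f holomorphic_on ball 0 1" and f0: "f 0 = 0"
    and le: "\<And>z. cmod z < 1 \<Longrightarrow> cmod (f z) \<le> 1"
  shows "f \<in> BMOA" "BMOA_norm f \<le> 1"
proof -
  have "f \<in> H2"
    by (rule H2_normI[OF f, of 1]) (use circle_mean2_le_1[OF f] le in auto)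
  moreover have "bmoa_shift f a \<in> H2 \<and> H2_norm (bmoa_shift f a) \<le> 1" if a: "cmod a < 1" for a
  proof -
    let ?h = "\<lambda>z. f (disc_aut a z)"
    have h: "?h holomorphic_on ball 0 1"
      by (rule holomorphic_on_compose_gen[OF disc_aut_holomorphic[OF a] f, unfolded o_def])
         (use norm_disc_aut_less_1[OF a] in auto)
    have "circle_mean2 (bmoa_shift f a) r \<le> 1" if r: "0 < r" "r < 1" for r
    proof -
      have "circle_mean2 (bmoa_shift f a) r \<le> circle_mean2 ?h r"
        using circle_mean2_diff_at_0_le[OF h r] by (simp add: bmoa_shift_def)
      also have "\<dots> \<le> 1" by (rule circle_mean2_le_1[OF h r]) (use le norm_disc_aut_less_1[OF a] in auto)
      finally show ?thesis .
    qed
    then show ?thesis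
      using H2_normI[OF bmoa_shift_holomorphic[OF f a], of 1] by simp
  qed
  ultimately have "f \<in> BMOA" "BMOA_norm f \<le> cmod (f 0) + 1"
    using BMOA_normI[of f 1] by auto
  then show "f \<in> BMOA" "BMOA_norm f \<le> 1" using f0 by auto
qed

section \<open>The integral operator on BMOA\<close>

lemma S_op_0 [simp]: "S_op g f 0 = 0"
  by (simp add: S_op_def)

lemma
  assumes f: "f holomorphic_on ball 0 1" and g: "g holomorphic_on ball 0 1" and z: "cmod z < 1"
  shows S_op_has_contour_integral:
      "((\<lambda>w. deriv f w * g w) has_contour_integral S_op g f z) (linepath 0 z)"
    and S_op_has_field_derivative: "(S_op g f has_field_derivative deriv f z * g z) (at z)"
proof -
  have "(\<lambda>w. deriv f w * g w) holomorphic_on ball 0 1"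
    by (intro holomorphic_intros holomorphic_deriv f g open_ball)
  then obtain P where P: "\<And>x. x \<in> ball 0 1 \<Longrightarrow> (P has_field_derivative deriv f x * g x) (at x within ball 0 1)"
    by (rule holomorphic_convex_primitive'[OF convex_ball open_ball]) auto
  have hci: "((\<lambda>w. deriv f w * g w) has_contour_integral (P x - P 0)) (linepath 0 x)"
    if "cmod x < 1" for x
    using contour_integral_primitive[OF P, of "linepath 0 x"] that
    by (simp add: closed_segment_subset)
  then have eq: "S_op g f x = P x - P 0" if "cmod x < 1" for x
    unfolding S_op_def using contour_integral_unique that by blast
  show "((\<lambda>w. deriv f w * g w) has_contour_integral S_op g f z) (linepath 0 z)"
    using hci eq z by simp
  have "((\<lambda>x. P x - P 0) has_field_derivative deriv f z * g z) (at z)"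
    using P[of z] z by (auto intro!: derivative_eq_intros simp: at_within_open[of z "ball 0 1"])
  then show "(S_op g f has_field_derivative deriv f z * g z) (at z)"
    by (rule has_field_derivative_transform_within_open[of _ _ _ "ball 0 1"]) (use z eq in auto)
qed

lemma S_op_holomorphic:
  assumes "f holomorphic_on ball 0 1" "g holomorphic_on ball 0 1"
  shows "S_op g f holomorphic_on ball 0 1"
  by (rule holomorphic_onI)
     (use S_op_has_field_derivative[OF assms] in \<open>auto simp: field_differentiable_def
        intro: has_field_derivative_at_within\<close>)

lemma S_op_add:
  assumes f: "f holomorphic_on ball 0 1" and h: "h holomorphic_on ball 0 1"
    and g: "g holomorphic_on ball 0 1" and z: "cmod z < 1"
  shows "S_op g (\<lambda>w. f w + h w) z = S_op g f z + S_op g h z"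
proof -
  have "((\<lambda>w. deriv f w * g w + deriv h w * g w) has_contour_integral (S_op g f z + S_op g h z)) (linepath 0 z)"
    by (intro has_contour_integral_add S_op_has_contour_integral f g h z)
  then have "((\<lambda>w. deriv (\<lambda>w. f w + h w) w * g w) has_contour_integral (S_op g f z + S_op g h z)) (linepath 0 z)"
  proof (rule has_contour_integral_eq)
    fix w assume "w \<in> path_image (linepath 0 z)"
    then have "w \<in> ball 0 1" using z closed_segment_subset[of 0 "ball 0 1" z] by auto
    then have "deriv (\<lambda>w. f w + h w) w = deriv f w + deriv h w"
      using f h by (intro deriv_add holomorphic_on_imp_differentiable_at[OF _ open_ball])
    then show "deriv f w * g w + deriv h w * g w = deriv (\<lambda>w. f w + h w) w * g w"
      by (simp add: distrib_right)
  qed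
  then show ?thesis by (simp add: S_op_def contour_integral_unique)
qed

lemma S_op_cmult:
  assumes f: "f holomorphic_on ball 0 1" and g: "g holomorphic_on ball 0 1" and z: "cmod z < 1"
  shows "S_op g (\<lambda>w. c * f w) z = c * S_op g f z"
proof -
  have "((\<lambda>w. c * (deriv f w * g w)) has_contour_integral (c * S_op g f z)) (linepath 0 z)"
    by (intro has_contour_integral_lmul S_op_has_contour_integral f g z)
  then have "((\<lambda>w. deriv (\<lambda>w. c * f w) w * g w) has_contour_integral (c * S_op g f z)) (linepath 0 z)"
  proof (rule has_contour_integral_eq)
    fix w assume "w \<in> path_image (linepath 0 z)"
    then have "w \<in> ball 0 1" using z closed_segment_subset[of 0 "ball 0 1" z] by auto
    then have "deriv (\<lambda>w. c * f w) w = c * deriv f w"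
      using f by (intro deriv_cmult holomorphic_on_imp_differentiable_at[OF _ open_ball])
    then show "c * (deriv f w * g w) = deriv (\<lambda>w. c * f w) w * g w"
      by simp
  qed
  then show ?thesis by (simp add: S_op_def contour_integral_unique)
qed

text \<open>
  The derivative of \<open>bmoa_shift (S_op g f) a\<close> is that of \<open>bmoa_shift f a\<close> multiplied by
  \<open>g \<circ> disc_aut a\<close>, which is bounded by \<open>M\<close>, so the Littlewood--Paley comparison applies
  to each shift.
\<close>

lemma S_op_in_BMOA:
  assumes g: "g holomorphic_on ball 0 1" and M: "\<And>z. cmod z < 1 \<Longrightarrow> cmod (g z) \<le> M"
    and f: "f \<in> BMOA"
  shows "S_op g f \<in> BMOA" "BMOA_norm (S_op g f) \<le> M * BMOA_norm f"
proof -
  have holf: "f holomorphic_on ball 0 1" by (rule BMOA_imp_holomorphic[OF f])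
  have holS: "S_op g f holomorphic_on ball 0 1" by (rule S_op_holomorphic[OF holf g])
  have dS: "deriv (S_op g f) z = deriv f z * g z" if "cmod z < 1" for z
    by (rule DERIV_imp_deriv[OF S_op_has_field_derivative[OF holf g that]])
  have M0: "M \<ge> 0" using M[of 0] norm_ge_zero[of "g 0"] by (simp del: norm_ge_zero)
  have fH2: "f \<in> H2" using f by (simp add: BMOA_def)
  have "S_op g f \<in> H2"
  proof (rule H2_normI[OF holS, of "M * H2_norm f"])
    fix r :: real assume r: "0 < r" "r < 1"
    have "circle_mean2 (S_op g f) r \<le> M\<^sup>2 * circle_mean2 f r"
      by (rule circle_mean2_comparison[OF holS holf r])
         (use dS M in \<open>auto simp: norm_mult mult.commute[of "cmod (deriv f _)"] intro!: mult_right_mono\<close>)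
    also have "\<dots> \<le> M\<^sup>2 * (H2_norm f)\<^sup>2"
      by (intro mult_left_mono circle_mean2_le_H2_norm fH2 r) auto
    finally show "circle_mean2 (S_op g f) r \<le> (M * H2_norm f)\<^sup>2"
      by (simp add: power_mult_distrib)
  qed (use M0 H2_norm_power2(2)[OF fH2] in auto)
  moreover have "bmoa_shift (S_op g f) a \<in> H2 \<and> H2_norm (bmoa_shift (S_op g f) a) \<le> M * BMOA_norm f"
    if a: "cmod a < 1" for a
  proof -
    let ?F = "bmoa_shift (S_op g f) a" and ?H = "bmoa_shift f a"
    have H2: "?H \<in> H2" using f a by (simp add: BMOA_def)
    have holF: "?F holomorphic_on ball 0 1" by (rule bmoa_shift_holomorphic[OF holS a])
    have *: "circle_mean2 ?F r \<le> (M * H2_norm ?H)\<^sup>2" if r: "0 < r" "r < 1" for r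
    proof -
      have "circle_mean2 ?F r \<le> M\<^sup>2 * circle_mean2 ?H r"
      proof (rule circle_mean2_comparison[OF holF bmoa_shift_holomorphic[OF holf a] r])
        fix z :: complex assume "z \<in> ball 0 1"
        then have z: "cmod z < 1" "cmod (disc_aut a z) < 1" using norm_disc_aut_less_1 a by auto
        have "deriv ?F z = g (disc_aut a z) * deriv ?H z"
          using DERIV_imp_deriv[OF bmoa_shift_has_field_derivative[OF holS a z(1)]]
            DERIV_imp_deriv[OF bmoa_shift_has_field_derivative[OF holf a z(1)]] dS[OF z(2)]
          by simp
        then show "cmod (deriv ?F z) \<le> M * cmod (deriv ?H z)"
          using M[OF z(2)] by (simp add: norm_mult mult_right_mono)
      qed simp
      also have "\<dots> \<le> M\<^sup>2 * (H2_norm ?H)\<^sup>2"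
        by (intro mult_left_mono circle_mean2_le_H2_norm H2 r) auto
      finally show ?thesis by (simp add: power_mult_distrib)
    qed
    have "?F \<in> H2" "H2_norm ?F \<le> M * H2_norm ?H"
      using H2_normI[OF holF _ *] M0 H2_norm_power2(2)[OF H2] by auto
    moreover have "H2_norm ?H \<le> BMOA_norm f"
      using H2_norm_bmoa_shift_le[OF f a] norm_ge_zero[of "f 0"] by linarith
    ultimately show ?thesis using M0 by (meson mult_left_mono order_trans)
  qed
  ultimately have "S_op g f \<in> BMOA" "BMOA_norm (S_op g f) \<le> cmod (S_op g f 0) + M * BMOA_norm f"
    using BMOA_normI[of "S_op g f" "M * BMOA_norm f"] by auto
  then show "S_op g f \<in> BMOA" "BMOA_norm (S_op g f) \<le> M * BMOA_norm f" by auto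
qed


section \<open>A sparse sequence along which the symbol is almost maximal\<close>

text \<open>
  By the maximum modulus principle, large values of \<open>g\<close> are also taken near the unit circle.
\<close>

lemma norm_near_Sup_near_circle:
  fixes B R :: real
  assumes g: "g holomorphic_on ball 0 1" and z: "cmod z < 1" "B < cmod (g z)" and R: "R < 1"
  shows "\<exists>a. R < cmod a \<and> cmod a < 1 \<and> B < cmod (g a)"
proof (rule ccontr)
  assume contr: "\<not> ?thesis"
  define s where "s = (1 + max R (cmod z)) / 2"
  have s: "R < s" "cmod z < s" "s < 1" using z R by (auto simp: s_def)
  have "cmod (g z) \<le> B"
  proof (rule maximum_modulus_frontier[of g "cball 0 s"])
    show "g holomorphic_on interior (cball 0 s)"
      by (rule holomorphic_on_subset[OF g]) (use s in auto)
    show "continuous_on (closure (cball 0 s)) g"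
      by (rule continuous_on_subset[OF holomorphic_on_imp_continuous_on[OF g]]) (use s in auto)
    show "cmod (g w) \<le> B" if "w \<in> frontier (cball 0 s)" for w
      using that contr s by (auto simp: not_less[symmetric])
  qed (use s in auto)
  then show False using z by simp
qed

text \<open>
  The pseudohyperbolic distance \<open>cmod (disc_aut b a)\<close> to finitely many given points tends
  to 1 as \<open>a\<close> approaches the unit circle.
\<close>

lemma disc_aut_near_circle:
  assumes "finite B" "\<And>b. b \<in> B \<Longrightarrow> cmod b < 1" "\<epsilon> > 0"
  shows "\<exists>R<1. \<forall>a. R < cmod a \<and> cmod a < 1 \<longrightarrow> (\<forall>b\<in>B. 1 - cmod (disc_aut b a) \<le> \<epsilon>)"
  using assms(1,2)
proof (induction B)
  case empty
  show ?case by (rule exI[of _ 0]) auto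
next
  case (insert b B)
  then obtain R where R: "R < 1"
    "\<And>a c. R < cmod a \<Longrightarrow> cmod a < 1 \<Longrightarrow> c \<in> B \<Longrightarrow> 1 - cmod (disc_aut c a) \<le> \<epsilon>"
    by auto
  have b: "cmod b < 1" using insert.prems by simp
  \<comment> \<open>chosen so that \<open>2 * (1 - cmod a) / (1 - cmod b)\<^sup>2 \<le> \<epsilon>\<close> whenever \<open>R' < cmod a\<close>\<close>
  define R' where "R' = 1 - \<epsilon> * (1 - cmod b)\<^sup>2 / 2"
  have "1 - cmod (disc_aut b a) \<le> \<epsilon>" if a: "R' < cmod a" "cmod a < 1" for a
  proof -
    let ?d = "cmod (disc_aut b a)"
    have pos: "0 < (1 - cmod b)\<^sup>2" using b by simp
    have "cmod (cnj b * a) \<le> cmod b * 1"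
      unfolding norm_mult complex_mod_cnj by (intro mult_left_mono) (use a in auto)
    then have "1 - cmod b \<le> cmod (1 - cnj b * a)"
      using norm_triangle_ineq2[of 1 "cnj b * a"] by simp
    then have den: "(1 - cmod b)\<^sup>2 \<le> (cmod (1 - cnj b * a))\<^sup>2"
      using b by (intro power_mono) auto
    have "?d\<^sup>2 \<le> ?d"
      using norm_disc_aut_less_1[OF b a(2)] by (simp add: power2_eq_square mult_left_le)
    then have "1 - ?d \<le> 1 - ?d\<^sup>2" by simp
    also have "\<dots> = (1 - (cmod b)\<^sup>2) * (1 - (cmod a)\<^sup>2) / (cmod (1 - cnj b * a))\<^sup>2"
      by (rule one_minus_norm_disc_aut_power2[OF b a(2)])
    also have "\<dots> \<le> 1 * (2 * (1 - cmod a)) / (1 - cmod b)\<^sup>2"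
    proof (intro frac_le mult_mono den pos)
      have "0 \<le> (1 - cmod a)\<^sup>2" by simp
      then show "1 - (cmod a)\<^sup>2 \<le> 2 * (1 - cmod a)" by (simp add: power2_eq_square algebra_simps)
    qed (use a b in \<open>auto simp: power_le_one\<close>)
    also have "\<dots> \<le> \<epsilon>"
      using a(1) pos by (simp add: R'_def pos_divide_le_eq)
    finally show ?thesis .
  qed
  moreover have "R' < 1" using b \<open>\<epsilon> > 0\<close> by (simp add: R'_def)
  ultimately show ?case using R by (intro exI[of _ "max R R'"]) auto
qed

text \<open>
  The points are chosen successively, each close enough to the unit circle for the
  previous ones.  Only the points after \<open>a 0 = 0\<close> need to make \<open>g\<close> large; the origin is included
  because the functions built from the sequence have to vanish there.
  The separation bound is written as a product in \<open>j\<close> and \<open>k\<close>, so that for fixed \<open>k\<close> it is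
  summable over \<open>j\<close> with a sum that tends to 0 as \<open>k\<close> grows.
\<close>

lemma sparse_maximizing_sequence:
  assumes g: "g holomorphic_on ball 0 1"
    and sup: "\<And>B. B < M \<Longrightarrow> \<exists>z. cmod z < 1 \<and> B < cmod (g z)"
  obtains a :: "nat \<Rightarrow> complex" where "a 0 = 0" "\<And>k. cmod (a k) < 1"
    "\<And>k. M - (1/2) ^ Suc k < cmod (g (a (Suc k)))"
    "\<And>j k. j \<noteq> k \<Longrightarrow> 1 - cmod (disc_aut (a j) (a k)) \<le> (1/2) ^ j * (1/2) ^ k"
proof -
  define P where "P = (\<lambda>(a :: nat \<Rightarrow> complex) k r. cmod r < 1 \<and>
     (if k = 0 then r = 0 else M - (1/2) ^ k < cmod (g r)) \<and>
     (\<forall>j<k. 1 - cmod (disc_aut (a j) r) \<le> (1/2) ^ j * (1/2) ^ k))"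
  have "\<exists>a. \<forall>k. P a k (a k)"
  proof (rule dependent_wellorder_choice)
    show "P f x r = P g x r" if "\<And>y. y < x \<Longrightarrow> f y = g y" for r f g x
      using that by (auto simp: P_def)
    show "\<exists>r. P a k r" if IH: "\<And>j. j < k \<Longrightarrow> P a j (a j)" for k a
    proof (cases "k = 0")
      case False
      have "\<exists>R<1. \<forall>r. R < cmod r \<and> cmod r < 1 \<longrightarrow>
          (\<forall>b\<in>a ` {..<k}. 1 - cmod (disc_aut b r) \<le> (1/2) ^ k * (1/2) ^ k)"
        by (rule disc_aut_near_circle) (use IH in \<open>auto simp: P_def\<close>)
      then obtain R where R: "R < 1" "\<And>r j. R < cmod r \<Longrightarrow> cmod r < 1 \<Longrightarrow> j < k \<Longrightarrow>
          1 - cmod (disc_aut (a j) r) \<le> (1/2) ^ k * (1/2) ^ k"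
        by auto
      obtain z where z: "cmod z < 1" "M - (1/2) ^ k < cmod (g z)"
        using sup[of "M - (1/2) ^ k"] by auto
      obtain r where r: "R < cmod r" "cmod r < 1" "M - (1/2) ^ k < cmod (g r)"
        using norm_near_Sup_near_circle[OF g z R(1)] by auto
      have "1 - cmod (disc_aut (a j) r) \<le> (1/2) ^ j * (1/2) ^ k" if "j < k" for j
      proof -
        have "(1/2::real) ^ k \<le> (1/2) ^ j" by (rule power_decreasing) (use that in auto)
        then have "(1/2::real) ^ k * (1/2) ^ k \<le> (1/2) ^ j * (1/2) ^ k" by (rule mult_right_mono) simp
        then show ?thesis using R(2)[OF r(1,2) that] by linarith
      qed
      then show ?thesis using r False by (auto simp: P_def)
    qed (auto simp: P_def)
  qed
  then obtain a where a: "\<And>k. P a k (a k)" by blast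
  show ?thesis
  proof (rule that)
    show "a 0 = 0" "cmod (a k) < 1" for k using a[of 0] a[of k] by (auto simp: P_def)
    show "M - (1/2) ^ Suc k < cmod (g (a (Suc k)))" for k
      using a[of "Suc k"] by (simp add: P_def)
    show "1 - cmod (disc_aut (a j) (a k)) \<le> (1/2) ^ j * (1/2) ^ k" if "j \<noteq> k" for j k
    proof (cases "j < k")
      case True
      then show ?thesis using a[of k] by (simp add: P_def)
    next
      case False
      then have "1 - cmod (disc_aut (a k) (a j)) \<le> (1/2) ^ k * (1/2) ^ j"
        using a[of j] that by (simp add: P_def)
      then show ?thesis by (simp only: norm_disc_aut_commute[of "a j"] mult.commute)
    qed
  qed
qed

section \<open>A Blaschke product with almost isometric hyperbolic derivative\<close>

text \<open>
  The hyperbolic derivative of the finite product at its zero \<open>a k\<close> is the product of the distances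
  \<open>cmod (disc_aut (a j) (a k))\<close> over \<open>j \<noteq> k\<close>, which the Weierstrass product inequality bounds
  from below.
\<close>

lemma finite_Blaschke_deriv_ge:
  fixes a :: "nat \<Rightarrow> complex"
  assumes a: "\<And>k. cmod (a k) < 1"
    and sparse: "\<And>j k. j \<noteq> k \<Longrightarrow> 1 - cmod (disc_aut (a j) (a k)) \<le> (1/2) ^ j * (1/2) ^ k"
    and k: "k \<le> n"
  shows "1 - 2 * (1/2) ^ k \<le>
    (1 - (cmod (a k))\<^sup>2) * cmod (deriv (\<lambda>z. \<Prod>j\<le>n. disc_aut (a j) z) (a k))"
proof -
  let ?I = "{..n} - {k}"
  let ?P = "\<lambda>z. \<Prod>j\<in>?I. disc_aut (a j) z"
  have split: "(\<Prod>j\<le>n. disc_aut (a j) z) = disc_aut (a k) z * ?P z" for z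
    by (rule prod.remove) (use k in auto)
  have "?P holomorphic_on ball 0 1"
    by (intro holomorphic_on_prod disc_aut_holomorphic a)
  then have "(?P has_field_derivative deriv ?P (a k)) (at (a k))"
    by (rule holomorphic_derivI) (use a in auto)
  then have "((\<lambda>z. disc_aut (a k) z * ?P z) has_field_derivative
      (- of_real (1 - (cmod (a k))\<^sup>2) / (1 - cnj (a k) * a k)\<^sup>2) * ?P (a k)) (at (a k))"
    using DERIV_mult[OF disc_aut_has_field_derivative[OF a a, of k k], of ?P] by simp
  then have D: "deriv (\<lambda>z. \<Prod>j\<le>n. disc_aut (a j) z) (a k)
      = (- of_real (1 - (cmod (a k))\<^sup>2) / (1 - cnj (a k) * a k)\<^sup>2) * ?P (a k)"
    unfolding split by (rule DERIV_imp_deriv)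
  define u where "u = 1 - (cmod (a k))\<^sup>2"
  have u: "u > 0" using a[of k] by (simp add: u_def power_less_one_iff)
  have "1 - cnj (a k) * a k = of_real u"
    unfolding u_def of_real_diff complex_norm_square by (simp add: mult.commute)
  with D have "cmod (deriv (\<lambda>z. \<Prod>j\<le>n. disc_aut (a j) z) (a k)) = u / u\<^sup>2 * cmod (?P (a k))"
    using u by (simp add: norm_mult norm_divide norm_power flip: u_def)
  then have "(1 - (cmod (a k))\<^sup>2) * cmod (deriv (\<lambda>z. \<Prod>j\<le>n. disc_aut (a j) z) (a k)) = cmod (?P (a k))"
    unfolding u_def[symmetric] using u by (simp add: power2_eq_square)
  moreover have "1 - 2 * (1/2) ^ k \<le> cmod (?P (a k))"
  proof -
    have "(\<Sum>j\<in>?I. 1 - cmod (disc_aut (a j) (a k))) \<le> (\<Sum>j\<in>?I. (1/2) ^ j * (1/2) ^ k)"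
      by (intro sum_mono sparse) auto
    also have "\<dots> = (\<Sum>j\<in>?I. (1/2) ^ j) * (1/2) ^ k" by (simp add: sum_distrib_right)
    also have "\<dots> \<le> 2 * (1/2) ^ k"
    proof (rule mult_right_mono)
      have "(\<Sum>j\<in>?I. (1/2::real) ^ j) \<le> (\<Sum>j. (1/2) ^ j)"
        by (rule sum_le_suminf) (auto intro: summable_geometric)
      then show "(\<Sum>j\<in>?I. (1/2::real) ^ j) \<le> 2" by (simp add: suminf_geometric)
    qed simp
    finally have "1 - 2 * (1/2) ^ k \<le> 1 - (\<Sum>j\<in>?I. 1 - cmod (disc_aut (a j) (a k)))" by simp
    also have "\<dots> \<le> (\<Prod>j\<in>?I. 1 - (1 - cmod (disc_aut (a j) (a k))))"
      by (rule Weierstrass_prod_ineq) (use norm_disc_aut_less_1[OF a a] in \<open>auto simp: less_imp_le\<close>)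
    finally show ?thesis by (simp flip: prod_norm)
  qed
  ultimately show ?thesis by simp
qed

text \<open>
  The lower bounds for the finite products do not depend on the number of factors.  By Montel's
  theorem some subsequence converges locally uniformly, and its limit inherits them.
\<close>

lemma Blaschke_limit:
  fixes a :: "nat \<Rightarrow> complex"
  assumes a0: "a 0 = 0" and a: "\<And>k. cmod (a k) < 1"
    and sparse: "\<And>j k. j \<noteq> k \<Longrightarrow> 1 - cmod (disc_aut (a j) (a k)) \<le> (1/2) ^ j * (1/2) ^ k"
  obtains f where "f holomorphic_on ball 0 1" "f 0 = 0" "\<And>z. cmod z < 1 \<Longrightarrow> cmod (f z) \<le> 1"
    "\<And>k. 1 - 2 * (1/2) ^ k \<le> (1 - (cmod (a k))\<^sup>2) * cmod (deriv f (a k))"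
proof -
  define b where "b = (\<lambda>n z. \<Prod>j\<le>n. disc_aut (a j) z)"
  define \<H> where "\<H> = {h. h holomorphic_on ball 0 1 \<and> (\<forall>z. cmod z < 1 \<longrightarrow> cmod (h z) \<le> 1)}"
  have holb: "b n holomorphic_on ball 0 1" for n
    unfolding b_def by (intro holomorphic_on_prod disc_aut_holomorphic a)
  have b1: "cmod (b n z) \<le> 1" if "cmod z < 1" for n z
    unfolding b_def prod_norm[symmetric]
    by (rule prod_le_1) (use norm_disc_aut_less_1[OF a that] in \<open>auto simp: less_imp_le\<close>)
  have b0: "b n 0 = 0" for n
    using a0 by (auto simp: b_def intro!: bexI[of _ 0])
  have 1: "h holomorphic_on ball 0 1" if "h \<in> \<H>" for h
    using that by (simp add: \<H>_def)
  have 2: "\<exists>B. \<forall>h\<in>\<H>. \<forall>z\<in>K. cmod (h z) \<le> B" if "compact K" "K \<subseteq> ball 0 1" for K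
    by (rule exI[of _ 1]) (use that in \<open>auto simp: \<H>_def\<close>)
  have 3: "range b \<subseteq> \<H>"
    using holb b1 by (auto simp: \<H>_def)
  obtain f s where f: "f holomorphic_on ball 0 1" and s: "strict_mono (s :: nat \<Rightarrow> nat)"
    and lim: "\<And>x. x \<in> ball 0 1 \<Longrightarrow> (\<lambda>n. b (s n) x) \<longlonglongrightarrow> f x"
    and ulim: "\<And>K. compact K \<Longrightarrow> K \<subseteq> ball 0 1 \<Longrightarrow> uniform_limit K (b \<circ> s) f sequentially"
    using Montel[OF open_ball 1 2 3] by metis
  show ?thesis
  proof (rule that)
    show "f holomorphic_on ball 0 1" by (rule f)
    show "f 0 = 0" using lim[of 0] by (simp add: b0 LIMSEQ_const_iff)
    show "cmod (f z) \<le> 1" if "cmod z < 1" for z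
      by (rule Lim_norm_ubound[OF _ lim[of z]]) (use that b1 in auto)
    show "1 - 2 * (1/2) ^ k \<le> (1 - (cmod (a k))\<^sup>2) * cmod (deriv f (a k))" for k
    proof -
      define t where "t = (1 + cmod (a k)) / 2"
      have t: "cmod (a k) < t" "t < 1" using a[of k] by (auto simp: t_def)
      have "(\<lambda>n. deriv ((b \<circ> s) n) (a k)) \<longlonglongrightarrow> deriv f (a k)"
      proof (rule deriv_complex_uniform_limit[where A = "ball 0 t"])
        show "uniform_limit (ball 0 t) (b \<circ> s) f sequentially"
          by (rule uniform_limit_on_subset[OF ulim[of "cball 0 t"]]) (use t in auto)
        show "\<forall>\<^sub>F n in sequentially. (b \<circ> s) n holomorphic_on ball 0 t"
          using t by (intro always_eventually allI) (auto intro!: holomorphic_on_subset[OF holb])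
      qed (use t in auto)
      then have "(\<lambda>n. (1 - (cmod (a k))\<^sup>2) * cmod (deriv (b (s n)) (a k)))
          \<longlonglongrightarrow> (1 - (cmod (a k))\<^sup>2) * cmod (deriv f (a k))"
        by (intro tendsto_intros) (simp add: o_def)
      moreover have "1 - 2 * (1/2) ^ k \<le> (1 - (cmod (a k))\<^sup>2) * cmod (deriv (b (s n)) (a k))"
        if "n \<ge> k" for n
        unfolding b_def
        by (rule finite_Blaschke_deriv_ge[OF a sparse]) (use that seq_suble[OF s, of n] in auto)
      ultimately show ?thesis
        by (intro LIMSEQ_le_const) auto
    qed
  qed
qed

section \<open>The norm is attained\<close>

theorem theorem5:
  fixes g :: "complex \<Rightarrow> complex"
  assumes "g \<in> H_inf"
  shows "norm_attaining BMOA BMOA_norm BMOA BMOA_norm (S_op g)"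
proof -
  have g: "g holomorphic_on ball 0 1" and "bounded (g ` ball 0 1)"
    using assms by (auto simp: H_inf_def)
  then have bdd: "bdd_above ((\<lambda>z. cmod (g z)) ` ball 0 1)"
    by (auto simp: bounded_iff bdd_above_def)
  define M where "M = (SUP z\<in>ball 0 1. cmod (g z))"
  have M: "cmod (g z) \<le> M" if "cmod z < 1" for z
    unfolding M_def by (rule cSUP_upper[OF _ bdd]) (use that in simp)
  have M0: "0 \<le> M" using order_trans[OF norm_ge_zero M[of 0]] by simp
  have sup: "\<exists>z. cmod z < 1 \<and> B < cmod (g z)" if "B < M" for B
    using that less_cSUP_iff[OF _ bdd, of B] unfolding M_def by auto
  note S = S_op_in_BMOA[OF g M]
  have lin: "bounded_linear_op BMOA BMOA_norm BMOA BMOA_norm (S_op g)"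
    unfolding bounded_linear_op_def
    using S S_op_add[OF BMOA_imp_holomorphic BMOA_imp_holomorphic g] S_op_cmult[OF BMOA_imp_holomorphic g] by auto
  obtain a where a0: "a 0 = 0" and a: "\<And>k. cmod (a k) < 1"
    and ga: "\<And>k. M - (1/2) ^ Suc k < cmod (g (a (Suc k)))"
    and sparse: "\<And>j k. j \<noteq> k \<Longrightarrow> 1 - cmod (disc_aut (a j) (a k)) \<le> (1/2) ^ j * (1/2) ^ k"
    using sparse_maximizing_sequence[OF g sup] by metis
  obtain f where f: "f holomorphic_on ball 0 1" "f 0 = 0" "\<And>z. cmod z < 1 \<Longrightarrow> cmod (f z) \<le> 1"
    and fa: "\<And>k. 1 - 2 * (1/2) ^ k \<le> (1 - (cmod (a k))\<^sup>2) * cmod (deriv f (a k))"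
    using Blaschke_limit[OF a0 a sparse] by metis
  have fB: "f \<in> BMOA" "BMOA_norm f \<le> 1" using self_map_in_BMOA[OF f] by auto
  have half: "(\<lambda>k. (1/2::real) ^ Suc k) \<longlonglongrightarrow> 0"
    by (intro LIMSEQ_Suc LIMSEQ_power_zero) simp
  have lim1: "(\<lambda>k. 1 - 2 * (1/2::real) ^ Suc k) \<longlonglongrightarrow> 1"
    using tendsto_diff[OF tendsto_const tendsto_mult_left[OF half, of 2], of 1] by simp
  have nf: "BMOA_norm f = 1"
  proof (rule antisym[OF fB(2)])
    show "1 \<le> BMOA_norm f"
      by (rule LIMSEQ_le_const2[OF lim1])
         (use fa hyperbolic_deriv_le_BMOA_norm[OF fB(1) a] order_trans in blast)
  qed
  \<comment> \<open>the lower bounds at the points \<open>a (Suc k)\<close> tend to \<open>M\<close>\<close>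
  have nS: "BMOA_norm (S_op g f) = M"
  proof (rule antisym)
    show "BMOA_norm (S_op g f) \<le> M" using S(2)[OF _ fB(1)] nf by simp
    have "(\<lambda>k. (1 - 2 * (1/2) ^ Suc k) * (M - (1/2) ^ Suc k)) \<longlonglongrightarrow> 1 * (M - 0)"
      by (intro tendsto_mult lim1 tendsto_diff half tendsto_const)
    moreover have "(1 - 2 * (1/2) ^ Suc k) * (M - (1/2) ^ Suc k) \<le> BMOA_norm (S_op g f)" for k
    proof -
      let ?b = "a (Suc k)"
      have "0 \<le> 1 - 2 * (1/2::real) ^ Suc k" by (simp add: power_le_one)
      then have "(1 - 2 * (1/2) ^ Suc k) * (M - (1/2) ^ Suc k)
          \<le> (1 - 2 * (1/2) ^ Suc k) * cmod (g ?b)"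
        using ga[of k] by (intro mult_left_mono) auto
      also have "\<dots> \<le> (1 - (cmod ?b)\<^sup>2) * cmod (deriv f ?b) * cmod (g ?b)"
        by (intro mult_right_mono fa) auto
      also have "\<dots> = (1 - (cmod ?b)\<^sup>2) * cmod (deriv (S_op g f) ?b)"
        using DERIV_imp_deriv[OF S_op_has_field_derivative[OF f(1) g a]] by (simp add: norm_mult)
      also have "\<dots> \<le> BMOA_norm (S_op g f)"
        by (rule hyperbolic_deriv_le_BMOA_norm[OF S(1)[OF _ fB(1)] a])
      finally show ?thesis .
    qed
    ultimately show "M \<le> BMOA_norm (S_op g f)" by (intro LIMSEQ_le_const2) auto
  qed
  have "op_norm BMOA BMOA_norm BMOA_norm (S_op g) = M"
    unfolding op_norm_def
  proof (rule cSup_eq_maximum)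
    show "M \<in> (\<lambda>f. BMOA_norm (S_op g f)) ` {f \<in> BMOA. BMOA_norm f \<le> 1}"
      using nS fB by auto
    fix x assume "x \<in> (\<lambda>f. BMOA_norm (S_op g f)) ` {f \<in> BMOA. BMOA_norm f \<le> 1}"
    then obtain h where h: "h \<in> BMOA" "BMOA_norm h \<le> 1" "x = BMOA_norm (S_op g h)" by auto
    have "x \<le> M * BMOA_norm h" using S(2)[OF _ h(1)] h(3) by simp
    also have "\<dots> \<le> M * 1" by (rule mult_left_mono[OF h(2) M0])
    finally show "x \<le> M" by simp
  qed
  then show ?thesis
    unfolding norm_attaining_def using lin fB(1) nf nS by auto
qed

end
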